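(* Let $n \ge 3$ be a fixed integer. Then there are only finitely many tuples $(a_1,\ldots,a_n,d) \in \mathbb{N}^{n+1}$ with $a_i \mid d$ for $i=1,\ldots,n$ and $\gcd(a_i,a_j)=1$ for $i \neq j$ such that the set $L_n = L_{a_1,\ldots,a_n,d,n}$ of solutions $(x_1,\ldots,x_n)\in\mathbb{N}^n$ of $$a_1x_1^2+\cdots+a_nx_n^2 = d\,x_1\cdots x_n$$ is non-empty. Moreover, for every such tuple with $L_n \ne \emptyset$, the set $F_n$ of fundamental solutions of this equation is finite.
   Context: $\mathbb{N}$ denotes the positive integers. For $n\ge 3$ and $a_1,\ldots,a_n,d\in\mathbb{N}$ with $a_i\mid d$ for all $i$ and $\gcd(a_i,a_j)=1$ for $i\ne j$, let $L_n=L_{a_1,\ldots,a_n,d,n}$ be the set of $(x_1,\ldots,x_n)\in\mathbb{N}^n$ with $a_1x_1^2+\cdots+a_nx_n^2=d\,x_1\cdots x_n$. For $i=1,\ldots,n$ let $\psi_i:L_n\to L_n$ be the permutation replacing the $i$-th coordinate $x_i$ by $x_i'=\frac{d}{a_i}\prod_{j\ne i}x_j-x_i$ and fixing the other coordinates. The height of $\overline{x}=(x_1,\ldots,x_n)\in L_n$ is $h(\overline{x})=x_1+\cdots+x_n$. An element $\overline{x}\in L_n$ is called a fundamental solution if $h(\psi_i(\overline{x}))\ge h(\overline{x})$ for all $i=1,\ldots,n$. $F_n$ denotes the set of fundamental solutions. *)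

theory Defs
  imports Complex_Main "HOL-Library.FuncSet"
begin

text \<open>
  The positive integers are the set \<open>{1..}\<close> of type \<^typ>\<open>nat set\<close>, and an \<open>n\<close>-tuple is a function on
  \<open>{1..n}\<close>. Tuples are extensional (\<open>undefined\<close> outside \<open>{1..n}\<close>), so that equality of functions
  is equality of tuples and finiteness of a set of functions is finiteness of the set of tuples.
\<close>

definition tuples :: "nat \<Rightarrow> (nat \<Rightarrow> nat) set" where
  "tuples n = {1..n} \<rightarrow>\<^sub>E {1..}"

definition coefficients :: "nat \<Rightarrow> ((nat \<Rightarrow> nat) \<times> nat) set" where
  "coefficients n = {(a, d). a \<in> tuples n \<and> d \<in> {1..} \<and> (\<forall>i\<in>{1..n}. a i dvd d) \<and>
     (\<forall>i\<in>{1..n}. \<forall>j\<in>{1..n}. i \<noteq> j \<longrightarrow> gcd (a i) (a j) = 1)}"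

definition solutions :: "nat \<Rightarrow> (nat \<Rightarrow> nat) \<Rightarrow> nat \<Rightarrow> (nat \<Rightarrow> nat) set" where
  "solutions n a d = {x \<in> tuples n. (\<Sum>i=1..n. a i * (x i)\<^sup>2) = d * (\<Prod>i=1..n. x i)}"

text \<open>
  For \<open>(a, d) \<in> coefficients n\<close> and \<open>x \<in> solutions n a d\<close> the division below is exact and the
  subtraction does not truncate; see \<open>psi_coordinate\<close> and \<open>psi_in_solutions\<close>.
\<close>

definition psi :: "nat \<Rightarrow> (nat \<Rightarrow> nat) \<Rightarrow> nat \<Rightarrow> nat \<Rightarrow> (nat \<Rightarrow> nat) \<Rightarrow> (nat \<Rightarrow> nat)" where
  "psi n a d i x = x(i := (d div a i) * (\<Prod>j\<in>{1..n} - {i}. x j) - x i)"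

definition height :: "nat \<Rightarrow> (nat \<Rightarrow> nat) \<Rightarrow> nat" where
  "height n x = (\<Sum>i=1..n. x i)"

definition fundamental_solutions :: "nat \<Rightarrow> (nat \<Rightarrow> nat) \<Rightarrow> nat \<Rightarrow> (nat \<Rightarrow> nat) set" where
  "fundamental_solutions n a d =
     {x \<in> solutions n a d. \<forall>i\<in>{1..n}. height n (psi n a d i x) \<ge> height n x}"

lemma psi_less:
  assumes n: "n \<ge> 2" and ad: "(a, d) \<in> coefficients n"
    and x: "x \<in> solutions n a d" and i: "i \<in> {1..n}"
  shows "x i < (d div a i) * (\<Prod>j\<in>{1..n} - {i}. x j)"
proof -
  let ?P = "\<Prod>j\<in>{1..n} - {i}. x j"
  have pos: "0 < a j" "0 < x j" if "j \<in> {1..n}" for j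
    using ad x that by (auto simp: coefficients_def solutions_def tuples_def PiE_iff Suc_le_eq)
  have d: "d = a i * (d div a i)"
    using ad i by (simp add: coefficients_def)
  define k where "k = (if i = 1 then 2 else 1 :: nat)"
  have k: "k \<in> {1..n} - {i}" using n by (auto simp: k_def)
  have "0 < a k * (x k)\<^sup>2" using pos[of k] k by simp
  also have "\<dots> \<le> (\<Sum>j\<in>{1..n} - {i}. a j * (x j)\<^sup>2)"
    using k by (intro member_le_sum) auto
  finally have "a i * (x i)\<^sup>2 < (\<Sum>j=1..n. a j * (x j)\<^sup>2)"
    using i by (simp add: sum.remove)
  also have "\<dots> = d * (x i * ?P)"
    using x i by (simp add: solutions_def prod.remove)
  also have "\<dots> = (a i * x i) * ((d div a i) * ?P)"
    by (subst d) simp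
  finally have "(a i * x i) * x i < (a i * x i) * ((d div a i) * ?P)"
    by (simp add: power2_eq_square mult.assoc)
  then show ?thesis by simp
qed

lemma psi_coordinate:
  assumes "n \<ge> 2" "(a, d) \<in> coefficients n" "x \<in> solutions n a d" "i \<in> {1..n}"
  shows "real (psi n a d i x i) = real d / real (a i) * (\<Prod>j\<in>{1..n} - {i}. real (x j)) - real (x i)"
proof -
  have "a i dvd d" using assms by (simp add: coefficients_def)
  then show ?thesis
    using psi_less[OF assms] by (simp add: psi_def of_nat_diff real_of_nat_div)
qed

lemma psi_in_solutions:
  assumes n: "n \<ge> 2" and ad: "(a, d) \<in> coefficients n"
    and x: "x \<in> solutions n a d" and i: "i \<in> {1..n}"
  shows "psi n a d i x \<in> solutions n a d"
proof -
  let ?P = "\<Prod>j\<in>{1..n} - {i}. x j" and ?y = "psi n a d i x"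
  let ?S = "\<Sum>j\<in>{1..n} - {i}. a j * (x j)\<^sup>2"
  define e where "e = d div a i"
  have d: "d = a i * e"
    using ad i by (simp add: coefficients_def e_def)
  have y: "?y i + x i = e * ?P" "0 < ?y i"
    using psi_less[OF assms] by (simp_all add: psi_def e_def)
  have other: "?y j = x j" if "j \<noteq> i" for j using that by (simp add: psi_def)
  have tup: "?y \<in> tuples n"
    using x y(2) i unfolding solutions_def tuples_def
    by (auto simp: psi_def PiE_iff extensional_def)
  have eq: "a i * (x i)\<^sup>2 + ?S = a i * (x i * (e * ?P))"
    using x i d by (simp add: solutions_def sum.remove prod.remove)
  then have "a i * (x i)\<^sup>2 + ?S = a i * (x i)\<^sup>2 + a i * (x i * ?y i)"
    unfolding y(1)[symmetric] by (simp add: algebra_simps power2_eq_square)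
  then have "?S = a i * (x i * ?y i)" by simp
  then have "a i * (?y i)\<^sup>2 + ?S = a i * (?y i * (e * ?P))"
    unfolding y(1)[symmetric] by (simp add: algebra_simps power2_eq_square)
  moreover have "(\<Sum>j=1..n. a j * (?y j)\<^sup>2) = a i * (?y i)\<^sup>2 + ?S"
    using i other by (simp add: sum.remove)
  moreover have "(\<Prod>j=1..n. ?y j) = ?y i * ?P"
    using i other by (simp add: prod.remove)
  ultimately show ?thesis
    using tup d by (simp add: solutions_def mult_ac)
qed

end

theory Submission
  imports Defs
begin

text \<open>
  A solution of minimal height is fundamental, so it suffices to bound \<open>d\<close> and the coordinates of a
  fundamental solution \<open>x\<close> in terms of \<open>n\<close>. Put \<open>y\<^sub>i = a\<^sub>i x\<^sub>i\<^sup>2\<close>, let \<open>y\<^sub>p \<ge> y\<^sub>q\<close> be the two largest of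
  these numbers, and let \<open>c > 0\<close> be the sum of the others. Fundamentality says that \<open>y\<^sub>p \<le> y\<^sub>q + c\<close>.
  By coprimality \<open>d = a\<^sub>p a\<^sub>q g\<close>, where each remaining \<open>a\<^sub>i\<close> divides \<open>g\<close>; with \<open>X\<close> the product of the
  remaining \<open>x\<^sub>i\<close> and \<open>M = d g X\<^sup>2\<close>, squaring the equation gives \<open>(y\<^sub>p + y\<^sub>q + c)\<^sup>2 = M y\<^sub>p y\<^sub>q\<close>.
  Here \<open>(t + s)\<^sup>2 / t\<close> decreases for \<open>t \<le> s\<close>, so replacing \<open>y\<^sub>p\<close> by \<open>y\<^sub>q\<close> yields
  \<open>M y\<^sub>q\<^sup>2 \<le> (2 y\<^sub>q + c)\<^sup>2 \<le> (n y\<^sub>q)\<^sup>2\<close>. Hence \<open>M \<le> n\<^sup>2\<close>, which bounds \<open>d\<close> and the remaining \<open>y\<^sub>i\<close>, thus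
  also \<open>c\<close>. Since \<open>M > 4\<close> by AM-GM, the same inequality bounds \<open>y\<^sub>q\<close> by \<open>5 c\<close>, and \<open>y\<^sub>p \<le> y\<^sub>q + c\<close>.
\<close>

lemma square_sum_le_of_balanced:
  fixes u v c M :: nat
  assumes "v \<le> u" "u \<le> v + c" "0 < u" and eq: "(u + v + c)\<^sup>2 = M * u * v"
  shows "M * v\<^sup>2 \<le> (2 * v + c)\<^sup>2"
proof -
  \<comment> \<open>With \<open>s = v + c\<close>, the left side is
    \<open>(u + s)^2 * v - (v + s)^2 * u\<close>, and \<open>v <= u <= s\<close> fixes its
    sign.\<close>
  have "(int u - int v) * (int u * int v - (int v + int c)\<^sup>2) \<le> 0"
  proof (rule mult_nonneg_nonpos)
    have "int u * int v \<le> (int v + int c) * (int v + int c)"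
      using assms by (intro mult_mono) auto
    then show "int u * int v - (int v + int c)\<^sup>2 \<le> 0" by (simp add: power2_eq_square)
  qed (use assms in simp)
  then have "int ((u + v + c)\<^sup>2 * v) \<le> int ((2 * v + c)\<^sup>2 * u)"
    by (simp add: algebra_simps power2_eq_square)
  then have "(u + v + c)\<^sup>2 * v \<le> (2 * v + c)\<^sup>2 * u"
    by (simp only: of_nat_le_iff)
  then have "u * (M * v\<^sup>2) \<le> u * (2 * v + c)\<^sup>2"
    unfolding eq by (simp add: algebra_simps power2_eq_square)
  then show ?thesis using assms by simp
qed

text \<open>If \<open>v > 5 * c\<close>, then \<open>4 * v * c + c * c <= 5 * v * c < v * v\<close>,
  so \<open>(2 * v + c)^2 < 5 * v^2\<close>.\<close>

lemma le_of_square_sum_bound: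
  fixes v c M :: nat
  assumes "M * v\<^sup>2 \<le> (2 * v + c)\<^sup>2" "5 \<le> M"
  shows "v \<le> 5 * c"
proof (rule ccontr)
  assume "\<not> v \<le> 5 * c"
  then have less: "5 * c < v" by simp
  have "5 * v\<^sup>2 \<le> (2 * v + c)\<^sup>2"
    using assms by (meson le_trans mult_le_mono1)
  then have "v * v \<le> 4 * v * c + c * c"
    by (simp add: algebra_simps power2_eq_square)
  moreover have "c * c \<le> v * c" using less by (intro mult_right_mono) auto
  moreover have "5 * (v * c) < v * v" using mult_strict_left_mono[OF less, of v] less by simp
  ultimately show False by linarith
qed

text \<open>Since \<open>c > 0\<close>, \<open>4 * u * v <= (u + v)^2 < (u + v + c)^2\<close>, and
  the strict step excludes even \<open>M = 4\<close>.\<close>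

lemma gt_four_of_square_sum_eq:
  fixes u v c M :: nat
  assumes "0 < c" and eq: "(u + v + c)\<^sup>2 = M * u * v"
  shows "5 \<le> M"
proof (rule ccontr)
  assume "\<not> 5 \<le> M"
  then have "M * (u * v) \<le> 4 * (u * v)" by (intro mult_right_mono) auto
  moreover have "4 * (int u * int v) \<le> (int u + int v)\<^sup>2"
    using zero_le_power2[of "int u - int v"] by (simp add: power2_eq_square algebra_simps)
  then have "int (4 * (u * v)) \<le> int ((u + v)\<^sup>2)" by simp
  then have "4 * (u * v) \<le> (u + v)\<^sup>2" by (simp only: of_nat_le_iff)
  moreover have "(u + v)\<^sup>2 < (u + v + c)\<^sup>2" using \<open>0 < c\<close> by (intro power_strict_mono) auto
  ultimately show False using eq by (simp only: mult.assoc)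
qed

text \<open>As a root of a quadratic, \<open>x i\<close> is at most the other root, hence at most
  half the root sum \<open>(d div a i) * ?P\<close>. Multiplying by \<open>2 * a i * x i\<close>
  compares \<open>2 * a i * (x i)^2\<close> with the whole sum.\<close>

lemma fundamental_solution_balanced:
  assumes ad: "(a, d) \<in> coefficients n" and x: "x \<in> fundamental_solutions n a d"
    and i: "i \<in> {1..n}"
  shows "a i * (x i)\<^sup>2 \<le> (\<Sum>j\<in>{1..n} - {i}. a j * (x j)\<^sup>2)"
proof -
  let ?P = "\<Prod>j\<in>{1..n} - {i}. x j"
  let ?S = "\<Sum>j\<in>{1..n} - {i}. a j * (x j)\<^sup>2"
  have d: "d = a i * (d div a i)" using ad i by (simp add: coefficients_def)
  have eq: "a i * (x i)\<^sup>2 + ?S = d * (x i * ?P)"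
    using x i by (simp add: fundamental_solutions_def solutions_def sum.remove prod.remove)
  have "0 < x i"
    using x i by (auto simp: fundamental_solutions_def solutions_def tuples_def PiE_iff Suc_le_eq)
  have "height n x \<le> height n (psi n a d i x)"
    using x i by (simp add: fundamental_solutions_def)
  then have "x i \<le> (d div a i) * ?P - x i"
    using i by (simp add: height_def psi_def sum.remove)
  \<comment> \<open>Positivity of \<open>x i\<close> shows that the difference above is not
    truncated.\<close>
  then have "2 * x i \<le> (d div a i) * ?P" using \<open>0 < x i\<close> by simp
  then have "(a i * x i) * (2 * x i) \<le> (a i * x i) * ((d div a i) * ?P)"
    by (rule mult_le_mono2)
  also have "\<dots> = d * (x i * ?P)" by (subst d) (simp add: mult_ac)
  finally have "2 * (a i * (x i)\<^sup>2) \<le> d * (x i * ?P)"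
    by (simp only: power2_eq_square mult_ac)
  with eq show ?thesis by simp
qed

text \<open>Each \<open>psi\<close> stays among the solutions, so none lowers a least
  height.\<close>

lemma ex_fundamental_solution:
  assumes "n \<ge> 2" "(a, d) \<in> coefficients n" "solutions n a d \<noteq> {}"
  shows "fundamental_solutions n a d \<noteq> {}"
proof -
  obtain x where "x \<in> solutions n a d"
      "\<And>z. z \<in> solutions n a d \<Longrightarrow> height n x \<le> height n z"
    using assms(3) ex_has_least_nat[of "\<lambda>x. x \<in> solutions n a d" _ "height n"] by blast
  then have "x \<in> fundamental_solutions n a d"
    using psi_in_solutions[OF assms(1,2)] by (auto simp: fundamental_solutions_def)
  then show ?thesis by blast
qed

lemma ex_two_largest:
  fixes y :: "'a \<Rightarrow> 'b :: linorder"
  assumes "finite A" "card A \<ge> 2"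
  obtains p q where "p \<in> A" "q \<in> A" "p \<noteq> q" "y q \<le> y p" "\<And>i. i \<in> A - {p, q} \<Longrightarrow> y i \<le> y q"
proof -
  have max: "\<exists>p\<in>B. \<forall>i\<in>B. y i \<le> y p" if "finite B" "B \<noteq> {}" for B
    using Max_in[of "y ` B"] Max_ge[of "y ` B"] that by fastforce
  have "A \<noteq> {}" using assms by auto
  then obtain p where p: "p \<in> A" "\<And>i. i \<in> A \<Longrightarrow> y i \<le> y p"
    using max[OF assms(1)] by blast
  have "card (A - {p}) \<noteq> 0" using assms p(1) by (simp add: card_Diff_singleton)
  then have "A - {p} \<noteq> {}" by (metis card.empty)
  then obtain q where "q \<in> A - {p}" "\<And>i. i \<in> A - {p} \<Longrightarrow> y i \<le> y q"
    using max[of "A - {p}"] assms(1) by blast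
  with p that show ?thesis by blast
qed

lemma fundamental_solution_bounds:
  assumes n: "n \<ge> 3" and ad: "(a, d) \<in> coefficients n"
    and x: "x \<in> fundamental_solutions n a d"
  shows "d \<le> n\<^sup>2" and "i \<in> {1..n} \<Longrightarrow> x i \<le> 6 * n ^ 3"
proof -
  define y where "y i = a i * (x i)\<^sup>2" for i
  have pos: "0 < a i" "0 < x i" if "i \<in> {1..n}" for i
    using ad x that
    by (auto simp: coefficients_def fundamental_solutions_def solutions_def tuples_def PiE_iff Suc_le_eq)
  have y_pos: "0 < y i" if "i \<in> {1..n}" for i
    using pos[OF that] by (simp add: y_def)
  obtain p q where pq: "p \<in> {1..n}" "q \<in> {1..n}" "p \<noteq> q" "y q \<le> y p"
    and max: "\<And>i. i \<in> {1..n} - {p, q} \<Longrightarrow> y i \<le> y q"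
    using ex_two_largest[of "{1..n}" y] n by auto
  define I where "I = {1..n} - {p, q}"
  have I: "finite I" "p \<notin> I" "q \<notin> I" "{1..n} = insert p (insert q I)" "I \<subseteq> {1..n}"
    using pq by (auto simp: I_def)
  have card_I: "card I = n - 2"
    using pq by (simp add: I_def card_Diff_subset)
  then have "I \<noteq> {}" using n by auto
  define c where "c = sum y I"
  define X where "X = prod x I"
  have "0 < c" unfolding c_def using \<open>I \<noteq> {}\<close> I y_pos by (intro sum_pos) auto
  have "0 < X" unfolding X_def using I pos by (intro prod_pos) auto

  have coprime: "coprime (a i) (a j)" if "i \<in> {1..n}" "j \<in> {1..n}" "i \<noteq> j" for i j
    using ad that by (simp add: coefficients_def coprime_iff_gcd_eq_1)
  have dvd: "a i dvd d" if "i \<in> {1..n}" for i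
    using ad that by (simp add: coefficients_def)
  have "a p * a q dvd d"
    using coprime dvd pq by (intro divides_mult) auto
  then obtain g where g: "d = a p * a q * g" by auto
  have "0 < d" using ad by (auto simp: coefficients_def)
  then have "0 < g" using g by (cases g) auto
  have dvd_g: "a i dvd g" if "i \<in> I" for i
  proof -
    have "coprime (a i) (a p * a q)"
      using coprime that I pq by (metis coprime_mult_right_iff in_mono)
    then show ?thesis
      using dvd[of i] that I g by (metis coprime_dvd_mult_right_iff in_mono)
  qed

  define M where "M = d * (g * X\<^sup>2)"
  have "y p + y q + c = d * (x p * x q * X)"
    using x pq I
    by (simp add: fundamental_solutions_def solutions_def y_def c_def X_def mult_ac add_ac)
  \<comment> \<open>One of the two factors \<open>d\<close> in the square is split as
    \<open>a p * a q * g\<close>, completing \<open>(x p)^2\<close> and \<open>(x q)^2\<close> to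
    \<open>y p\<close> and \<open>y q\<close>.\<close>
  then have eq: "(y p + y q + c)\<^sup>2 = M * y p * y q"
    by (simp add: M_def y_def g power2_eq_square mult_ac)
  have "{1..n} - {p} = insert q I" using pq by (auto simp: I_def)
  then have yp_le: "y p \<le> y q + c"
    using fundamental_solution_balanced[OF ad x pq(1)] I by (simp add: y_def c_def)
  have ineq: "M * (y q)\<^sup>2 \<le> (2 * y q + c)\<^sup>2"
    using square_sum_le_of_balanced[OF pq(4) yp_le y_pos[OF pq(1)] eq] .

  have "c \<le> (n - 2) * y q"
    using sum_bounded_above[of I y "y q"] max card_I by (simp add: c_def I_def)
  then have "2 * y q + c \<le> 2 * y q + (n - 2) * y q" by simp
  also have "\<dots> = (2 + (n - 2)) * y q" by (simp only: distrib_right)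
  also have "2 + (n - 2) = n" using n by simp
  finally have "(2 * y q + c)\<^sup>2 \<le> (n * y q)\<^sup>2" by (rule power_mono) simp
  with ineq have "M * (y q)\<^sup>2 \<le> n\<^sup>2 * (y q)\<^sup>2"
    unfolding power_mult_distrib by (rule le_trans)
  then have M_le: "M \<le> n\<^sup>2" using y_pos[OF pq(2)] by simp
  have "d \<le> M" using \<open>0 < g\<close> \<open>0 < X\<close> by (simp add: M_def)
  then show "d \<le> n\<^sup>2" using M_le by simp

  \<comment> \<open>Both \<open>a i dvd g\<close> and \<open>x i dvd X\<close>, so
    \<open>y i\<close> is at most the factor \<open>g * X^2\<close> of \<open>M\<close>.\<close>
  have "y i \<le> n\<^sup>2" if "i \<in> I" for i
  proof -
    have "a i \<le> g" using dvd_g[OF that] \<open>0 < g\<close> by (rule dvd_imp_le)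
    moreover have "x i \<le> X"
      using dvd_prodI[OF I(1) that, of x] \<open>0 < X\<close> by (simp add: X_def dvd_imp_le)
    ultimately have "y i \<le> g * X\<^sup>2" by (simp add: y_def mult_le_mono power_mono)
    also have "\<dots> \<le> M" using \<open>0 < d\<close> by (simp add: M_def)
    finally show ?thesis using M_le by simp
  qed
  then have "c \<le> (n - 2) * n\<^sup>2"
    using sum_bounded_above[of I y "n\<^sup>2"] card_I by (simp add: c_def)
  also have "\<dots> \<le> n * n\<^sup>2" by (rule mult_le_mono1) simp
  also have "\<dots> = n ^ 3" by (simp add: power3_eq_cube power2_eq_square)
  finally have c_le: "c \<le> n ^ 3" .
  have "y q \<le> 5 * c"
    using le_of_square_sum_bound[OF ineq gt_four_of_square_sum_eq[OF \<open>0 < c\<close> eq]] .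
  \<comment> \<open>The 6 arises from \<open>y p <= y q + c <= 5 * c + c\<close>.\<close>
  then have yp: "y p \<le> 6 * n ^ 3" using yp_le c_le by simp
  assume i: "i \<in> {1..n}"
  have "y i \<le> y p" using i max pq by (cases "i = p \<or> i = q") (auto intro: order_trans)
  moreover have "x i \<le> y i"
    using pos[OF i] by (simp add: y_def power2_eq_square)
  ultimately show "x i \<le> 6 * n ^ 3" using yp by simp
qed

theorem theorem3p11:
  fixes n :: nat
  assumes "n \<ge> 3"
  shows "finite {(a, d). (a, d) \<in> coefficients n \<and> solutions n a d \<noteq> {}} \<and>
    (\<forall>a d. (a, d) \<in> coefficients n \<and> solutions n a d \<noteq> {} \<longrightarrow> finite (fundamental_solutions n a d))"
proof (intro conjI allI impI)
  let ?T = "{1..n} \<rightarrow>\<^sub>E {..n\<^sup>2}"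
  \<comment> \<open>A fundamental solution exists and bounds \<open>d\<close>; divisibility passes
    the bound on to each \<open>a i\<close>.\<close>
  have "(a, d) \<in> ?T \<times> {..n\<^sup>2}" if ad: "(a, d) \<in> coefficients n" "solutions n a d \<noteq> {}" for a d
  proof -
    have "d \<le> n\<^sup>2"
      using ex_fundamental_solution[OF _ ad] fundamental_solution_bounds(1)[OF assms ad(1)] assms
      by fastforce
    moreover have "a i \<le> d" if "i \<in> {1..n}" for i
      using ad(1) that by (auto simp: coefficients_def intro: dvd_imp_le)
    ultimately have "a i \<le> n\<^sup>2" if "i \<in> {1..n}" for i
      using that by (meson le_trans)
    with \<open>d \<le> n\<^sup>2\<close> show ?thesis
      using ad(1) by (simp add: coefficients_def tuples_def PiE_iff)
  qed
  then have "{(a, d). (a, d) \<in> coefficients n \<and> solutions n a d \<noteq> {}} \<subseteq> ?T \<times> {..n\<^sup>2}"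
    by auto
  then show "finite {(a, d). (a, d) \<in> coefficients n \<and> solutions n a d \<noteq> {}}"
    by (rule finite_subset) (intro finite_cartesian_product finite_PiE finite_atLeastAtMost finite_atMost)
next
  fix a d assume "(a, d) \<in> coefficients n \<and> solutions n a d \<noteq> {}"
  then have ad: "(a, d) \<in> coefficients n" ..
  have "fundamental_solutions n a d \<subseteq> {1..n} \<rightarrow>\<^sub>E {..6 * n ^ 3}"
  proof
    fix x assume x: "x \<in> fundamental_solutions n a d"
    then have "x \<in> extensional {1..n}"
      by (simp add: fundamental_solutions_def solutions_def tuples_def PiE_iff)
    with fundamental_solution_bounds(2)[OF assms ad x] show "x \<in> {1..n} \<rightarrow>\<^sub>E {..6 * n ^ 3}"
      by (simp add: PiE_iff)
  qed
  then show "finite (fundamental_solutions n a d)"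
    by (rule finite_subset) (simp add: finite_PiE)
qed

end
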